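(* Let $M$ be a cancellative monoid equipped with a discrete degree map $\deg: M\to\mathbb{R}_{\ge 0}$. Let $$P_{M,\deg}(t):=\sum_{u\in M/\sim} t^{\deg(u)}$$ be the growth function of $(M,\deg)$, and let $$N_{M,\deg}(t):=1+\sum_{T\in \mathrm{Tmcm}(M,I_0)}(-1)^{\#J_1+\cdots+\#J_n-n+1}\sum_{\Delta\in |T|}t^{\deg(\Delta)}$$ be its skew-growth function, where $I_0:=\min\big((M/\!\sim)\setminus\{[1]\}\big)$ and $T=(I_0,J_1,\dots,J_n)$ runs over all towers (of arbitrary height $n\ge 0$) with ground $I_0$. Then, in the ring $R_{\mathbb{Z}}$, $$P_{M,\deg}(t)\cdot N_{M,\deg}(t)=1.$$
   Context: A monoid $M$ (a semigroup with unit $1$) is cancellative if $aub=avb$ implies $u=v$ for all $a,b,u,v\in M$. For $u,v\in M$ write $u\mid_l v$ if $v=ux$ for some $x\in M$, and $u\sim v$ if $u\mid_l v$ and $v\mid_l u$. The quotient set $M/\!\sim$ is partially ordered by $[u]\le[v]\Leftrightarrow u\mid_l v$; write $u<v$ if $u\mid_l v$ and $u\not\sim v$. Elements of $M$ and their classes are denoted by the same letter when no confusion arises. A discrete degree map on $M$ is a map $\deg:M\to\mathbb{R}_{\ge0}$ such that (i) $\deg(u)=0$ if and only if $u\sim 1$; (ii) $\deg(uv)=\deg(u)+\deg(v)$ for all $u,v\in M$; (iii) $\#\{u\in M/\!\sim\ \mid \deg(u)\le r\}<\infty$ for every $r\in\mathbb{R}_{>0}$. (By (ii), $\deg$ is well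 defined on $M/\!\sim$.) For a subset $J\subset M/\!\sim$ put $\mathrm{cm}(J):=\{u\in M/\!\sim\ \mid j\mid_l u\ \text{for all } j\in J\}$, $\min(J):=\{u\in J\mid \text{there is no } v\in J \text{ with } v<u\}$, and $\mathrm{mcm}(J):=\min(\mathrm{cm}(J))$. A tower of height $n\in\mathbb{Z}_{\ge0}$ in $M$ is a sequence $T=(I_0,J_1,\dots,J_n)$ of subsets of $(M/\!\sim)\setminus\{[1]\}$ such that: (i) $I_0\ne\emptyset$ and $I_0=\min(I_0)$; (ii) $I_k:=\mathrm{mcm}(J_k)\neq\emptyset$ for $k=1,\dots,n$; (iii) $J_k\subset I_{k-1}$ and $\#J_k>1$ for $k=1,\dots,n$. The set $I_0$ is the ground of $T$, and $|T|:=I_n$ (so $|T|=I_0$ if $n=0$ and $|T|=\mathrm{mcm}(J_n)$ if $n>0$). $\mathrm{Tmcm}(M,I_0)$ denotes the set of all towers with ground $I_0$. (The sets $J_k$ are automatically finite, because $\mathrm{mcm}(J_k)\neq\emptyset$ and $\deg$ is discrete.) If $I_0=\emptyset$, i.e. $M/\!\sim\,=\{[1]\}$, the sum over towers is empty and $N_{M,\deg}(t)=1$. $R_{\mathbb{Z}}$ is the ring of formal series $\sum_{n=0}^\infty a_n t^{d_n}$ with $a_n\in\mathbb{Z}$ and $(d_n)$ a sequence in $\mathbb{R}_{\ge0}$ diverging to $+\infty$ (equivalently, functions $\mathbb{R}_{\ge0}\to\mathbb{Z}$ whose support meets every bounded interval in a finite set), with product $\big(\sum a_nt^{d_n}\big)\big(\sum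 b_mt^{e_m}\big)=\sum_{d\in\mathbb{R}_{\ge 0}}\big(\sum_{d_n+e_m=d}a_nb_m\big)t^d$, and with the topology for which the sets $t^dR_{\mathbb{Z}}$ ($d\in\mathbb{R}_{\ge0}$), consisting of the series all of whose exponents with nonzero coefficient are $\ge d$, form a system of neighbourhoods of $0$. The infinite sums defining $P_{M,\deg}(t)$ and $N_{M,\deg}(t)$ are taken in this topology: for each real $r$, only finitely many terms contribute to exponents $\le r$. *)

theory Defs
  imports "HOL-Algebra.Divisibility" "HOL-Analysis.Infinite_Sum"
begin

section \<open>The topological ring of formal series with real exponents\<close>

text \<open>A series is given by its coefficient function, whose support lies in the nonnegative
  reals and meets every bounded interval in a finite set.\<close>

typedef rz_series =
  "{f :: real \<Rightarrow> int. (\<forall>d<0. f d = 0) \<and> (\<forall>r. finite {d. d \<le> r \<and> f d \<noteq> 0})}"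
  morphisms rz_coeff Abs_rz_series
  by (rule exI[of _ "\<lambda>_. 0"]) simp

setup_lifting type_definition_rz_series

lemma rz_series_eqI: "(\<And>d. rz_coeff f d = rz_coeff g d) \<Longrightarrow> f = g"
  by (metis ext rz_coeff_inject)

lemma rz_coeff_neg: "d < 0 \<Longrightarrow> rz_coeff f d = 0"
  using rz_coeff[of f] by auto

lemma finite_rz_support: "finite {d. d \<le> r \<and> rz_coeff f d \<noteq> 0}"
  using rz_coeff[of f] by auto

text \<open>The series \<open>t\<^sup>d\<close> for \<open>d \<ge> 0\<close> (and 0 for \<open>d < 0\<close>).\<close>

lift_definition rz_monom :: "real \<Rightarrow> rz_series" is
  "\<lambda>d e. if e = d \<and> 0 \<le> d then 1 else 0"
proof -
  fix d :: real
  have "finite {e. e \<le> r \<and> (if e = d \<and> 0 \<le> d then 1 else 0 :: int) \<noteq> 0}" for r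
    by (rule finite_subset[of _ "{d}"]) auto
  then show "(\<forall>e<0. (if e = d \<and> 0 \<le> d then 1 else 0 :: int) = 0) \<and>
      (\<forall>r. finite {e. e \<le> r \<and> (if e = d \<and> 0 \<le> d then 1 else 0 :: int) \<noteq> 0})"
    by auto
qed

definition conv_support :: "(real \<Rightarrow> int) \<Rightarrow> (real \<Rightarrow> int) \<Rightarrow> real \<Rightarrow> (real \<times> real) set" where
  "conv_support f g d = {(a, b). f a \<noteq> 0 \<and> g b \<noteq> 0 \<and> a + b = d}"

lemma conv_sum_eq:
  fixes f g :: "real \<Rightarrow> int"
  assumes "finite A" "{a. f a \<noteq> 0 \<and> g (d - a) \<noteq> 0} \<subseteq> A"
  shows "(\<Sum>(a, b)\<in>conv_support f g d. f a * g b) = (\<Sum>a\<in>A. f a * g (d - a))"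
proof -
  have "(\<Sum>(a, b)\<in>conv_support f g d. f a * g b)
      = (\<Sum>a\<in>{a. f a \<noteq> 0 \<and> g (d - a) \<noteq> 0}. f a * g (d - a))"
    by (rule sum.reindex_bij_witness[of _ "\<lambda>a. (a, d - a)" fst]) (auto simp: conv_support_def)
  also have "\<dots> = (\<Sum>a\<in>A. f a * g (d - a))"
    using assms by (intro sum.mono_neutral_left) auto
  finally show ?thesis .
qed

instantiation rz_series :: comm_ring_1
begin

lift_definition zero_rz_series :: rz_series is "\<lambda>_. 0" by simp

definition one_rz_series :: rz_series where "one_rz_series = rz_monom 0"

lift_definition plus_rz_series :: "rz_series \<Rightarrow> rz_series \<Rightarrow> rz_series" is "\<lambda>f g d. f d + g d"
proof -
  fix f g :: "real \<Rightarrow> int"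
  assume f: "(\<forall>d<0. f d = 0) \<and> (\<forall>r. finite {d. d \<le> r \<and> f d \<noteq> 0})"
    and g: "(\<forall>d<0. g d = 0) \<and> (\<forall>r. finite {d. d \<le> r \<and> g d \<noteq> 0})"
  have "finite {d. d \<le> r \<and> f d + g d \<noteq> 0}" for r
    by (rule finite_subset[of _ "{d. d \<le> r \<and> f d \<noteq> 0} \<union> {d. d \<le> r \<and> g d \<noteq> 0}"])
      (use f g in auto)
  then show "(\<forall>d<0. f d + g d = 0) \<and> (\<forall>r. finite {d. d \<le> r \<and> f d + g d \<noteq> 0})"
    using f g by auto
qed

lift_definition uminus_rz_series :: "rz_series \<Rightarrow> rz_series" is "\<lambda>f d. - f d" by simp

definition minus_rz_series :: "rz_series \<Rightarrow> rz_series \<Rightarrow> rz_series" where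
  "minus_rz_series f g = f + - g"

lift_definition times_rz_series :: "rz_series \<Rightarrow> rz_series \<Rightarrow> rz_series" is
  "\<lambda>f g d. \<Sum>(a, b)\<in>conv_support f g d. f a * g b"
proof -
  fix f g :: "real \<Rightarrow> int"
  let ?h = "\<lambda>d. \<Sum>(a, b)\<in>conv_support f g d. f a * g b"
  assume f: "(\<forall>d<0. f d = 0) \<and> (\<forall>r. finite {d. d \<le> r \<and> f d \<noteq> 0})"
    and g: "(\<forall>d<0. g d = 0) \<and> (\<forall>r. finite {d. d \<le> r \<and> g d \<noteq> 0})"
  have nonneg: "0 \<le> a \<and> 0 \<le> b" if "f a \<noteq> 0" "g b \<noteq> 0" for a b
    using f g that by (meson not_le)
  have ex: "\<exists>a b. f a \<noteq> 0 \<and> g b \<noteq> 0 \<and> a + b = d" if "?h d \<noteq> 0" for d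
  proof -
    have "conv_support f g d \<noteq> {}" using that by force
    then show ?thesis by (auto simp: conv_support_def)
  qed
  have "finite {d. d \<le> r \<and> ?h d \<noteq> 0}" for r
  proof (rule finite_subset)
    show "{d. d \<le> r \<and> ?h d \<noteq> 0} \<subseteq>
        (\<lambda>(a, b). a + b) ` ({a. a \<le> r \<and> f a \<noteq> 0} \<times> {b. b \<le> r \<and> g b \<noteq> 0})"
    proof clarify
      fix d assume d: "d \<le> r" "?h d \<noteq> 0"
      then obtain a b where "f a \<noteq> 0" "g b \<noteq> 0" "a + b = d" using ex by blast
      with nonneg[of a b] d(1)
      show "d \<in> (\<lambda>(a, b). a + b) ` ({a. a \<le> r \<and> f a \<noteq> 0} \<times> {b. b \<le> r \<and> g b \<noteq> 0})"
        by (intro image_eqI[of _ _ "(a, b)"]) auto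
    qed
    show "finite ((\<lambda>(a, b). a + b) ` ({a. a \<le> r \<and> f a \<noteq> 0} \<times> {b. b \<le> r \<and> g b \<noteq> 0}))"
      using f g by auto
  qed
  moreover have "?h d = 0" if "d < 0" for d
    using ex[of d] nonneg that by fastforce
  ultimately show "(\<forall>d<0. ?h d = 0) \<and> (\<forall>r. finite {d. d \<le> r \<and> ?h d \<noteq> 0})"
    by blast
qed

lemma rz_coeff_times_left:
  assumes "finite A" "{a. a \<le> d \<and> rz_coeff f a \<noteq> 0} \<subseteq> A"
  shows "rz_coeff (f * g) d = (\<Sum>a\<in>A. rz_coeff f a * rz_coeff g (d - a))"
proof -
  have "{a. rz_coeff f a \<noteq> 0 \<and> rz_coeff g (d - a) \<noteq> 0} \<subseteq> A"
  proof clarify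
    fix a assume "rz_coeff f a \<noteq> 0" "rz_coeff g (d - a) \<noteq> 0"
    then show "a \<in> A" using assms(2) rz_coeff_neg[of "d - a" g] by force
  qed
  then show ?thesis
    unfolding times_rz_series.rep_eq by (rule conv_sum_eq[OF assms(1)])
qed

lemma rz_mult_commute: "f * g = g * (f :: rz_series)"
proof (rule rz_series_eqI)
  fix d
  show "rz_coeff (f * g) d = rz_coeff (g * f) d"
    unfolding times_rz_series.rep_eq
    by (rule sum.reindex_bij_witness[of _ prod.swap prod.swap])
      (auto simp: conv_support_def)
qed

instance
proof
  fix f g h :: rz_series
  show "f + g + h = f + (g + h)" "f + g = g + f" "0 + f = f" "- f + f = 0"
    by (transfer; simp add: fun_eq_iff)+
  show "f - g = f + - g" by (rule minus_rz_series_def)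
  show "f * g = g * f" by (rule rz_mult_commute)
  show "(0::rz_series) \<noteq> 1"
    unfolding one_rz_series_def by transfer (auto simp: fun_eq_iff)
  show "1 * f = f"
  proof (rule rz_series_eqI)
    fix d
    have "rz_coeff (1 * f) d = (\<Sum>a\<in>{0}. rz_coeff 1 a * rz_coeff f (d - a))"
      by (rule rz_coeff_times_left) (auto simp: one_rz_series_def rz_monom.rep_eq split: if_splits)
    then show "rz_coeff (1 * f) d = rz_coeff f d"
      by (simp add: one_rz_series_def rz_monom.rep_eq)
  qed
  show "(f + g) * h = f * h + g * h"
  proof (rule rz_series_eqI)
    fix d
    let ?A = "{a. a \<le> d \<and> rz_coeff f a \<noteq> 0} \<union> {a. a \<le> d \<and> rz_coeff g a \<noteq> 0}"
    have fin: "finite ?A" by (simp add: finite_rz_support)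
    show "rz_coeff ((f + g) * h) d = rz_coeff (f * h + g * h) d"
      by (simp add: plus_rz_series.rep_eq rz_coeff_times_left[OF fin] subset_iff
          sum.distrib[symmetric] distrib_right)
  qed
  show "f * g * h = f * (g * h)"
  proof (rule rz_series_eqI)
    fix d
    let ?A = "{a. a \<le> d \<and> rz_coeff f a \<noteq> 0}" and ?C = "{c. c \<le> d \<and> rz_coeff h c \<noteq> 0}"
    note fin = finite_rz_support[of d f] finite_rz_support[of d h]
    have A: "rz_coeff (f * g) (d - c) = (\<Sum>a\<in>?A. rz_coeff f a * rz_coeff g (d - c - a))"
      if "c \<in> ?C" for c
    proof (rule rz_coeff_times_left[OF fin(1)])
      have "0 \<le> c" using that rz_coeff_neg[of c h] by force
      then show "{a. a \<le> d - c \<and> rz_coeff f a \<noteq> 0} \<subseteq> ?A" by auto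
    qed
    have C: "rz_coeff (g * h) (d - a) = (\<Sum>c\<in>?C. rz_coeff h c * rz_coeff g (d - a - c))"
      if "a \<in> ?A" for a
      unfolding rz_mult_commute[of g h]
    proof (rule rz_coeff_times_left[OF fin(2)])
      have "0 \<le> a" using that rz_coeff_neg[of a f] by force
      then show "{c. c \<le> d - a \<and> rz_coeff h c \<noteq> 0} \<subseteq> ?C" by auto
    qed
    have "rz_coeff (f * g * h) d = (\<Sum>c\<in>?C. rz_coeff h c * rz_coeff (f * g) (d - c))"
      unfolding rz_mult_commute[of "f * g" h] by (rule rz_coeff_times_left[OF fin(2)]) simp
    also have "\<dots> = (\<Sum>c\<in>?C. \<Sum>a\<in>?A. rz_coeff f a * (rz_coeff h c * rz_coeff g (d - a - c)))"
      by (rule sum.cong[OF refl], subst A) (auto simp: sum_distrib_left algebra_simps)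
    also have "\<dots> = (\<Sum>a\<in>?A. \<Sum>c\<in>?C. rz_coeff f a * (rz_coeff h c * rz_coeff g (d - a - c)))"
      by (rule sum.swap)
    also have "\<dots> = (\<Sum>a\<in>?A. rz_coeff f a * rz_coeff (g * h) (d - a))"
      by (rule sum.cong[OF refl], subst C) (auto simp: sum_distrib_left)
    also have "\<dots> = rz_coeff (f * (g * h)) d"
      by (rule rz_coeff_times_left[OF fin(1), symmetric]) simp
    finally show "rz_coeff (f * g * h) d = rz_coeff (f * (g * h)) d" .
  qed
qed

end

text \<open>The sets \<open>f + t\<^sup>d R\<close>, for \<open>d \<ge> 0\<close>, form a neighbourhood base at \<open>f\<close>.\<close>

definition rz_ideal :: "real \<Rightarrow> rz_series set" where
  "rz_ideal d = {f. \<forall>e<d. rz_coeff f e = 0}"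

lemma rz_coeff_minus: "rz_coeff (f - g) d = rz_coeff f d - rz_coeff g d"
  unfolding minus_rz_series_def plus_rz_series.rep_eq uminus_rz_series.rep_eq by simp

instantiation rz_series :: t2_space
begin

definition open_rz_series :: "rz_series set \<Rightarrow> bool" where
  "open_rz_series U \<longleftrightarrow> (\<forall>f\<in>U. \<exists>d\<ge>0. {g. g - f \<in> rz_ideal d} \<subseteq> U)"

instance
proof
  show "open (UNIV :: rz_series set)"
    by (auto simp: open_rz_series_def)
  show "open (S \<inter> T)" if S: "open S" and T: "open T" for S T :: "rz_series set"
    unfolding open_rz_series_def
  proof
    fix f assume "f \<in> S \<inter> T"
    then obtain d e where "d \<ge> 0" "{g. g - f \<in> rz_ideal d} \<subseteq> S" "{g. g - f \<in> rz_ideal e} \<subseteq> T"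
      using S T unfolding open_rz_series_def by (meson IntD1 IntD2)
    then show "\<exists>d\<ge>0. {g. g - f \<in> rz_ideal d} \<subseteq> S \<inter> T"
      by (intro exI[of _ "max d e"]) (auto simp: rz_ideal_def)
  qed
  show "open (\<Union>K)" if "\<forall>S\<in>K. open S" for K :: "rz_series set set"
    using that unfolding open_rz_series_def by (meson Sup_upper UnionE order_trans)
  show "\<exists>U V. open U \<and> open V \<and> f \<in> U \<and> g \<in> V \<and> U \<inter> V = {}"
    if ne: "f \<noteq> g" for f g :: rz_series
  proof -
    obtain d where d: "rz_coeff f d \<noteq> rz_coeff g d"
      using ne rz_series_eqI[of f g] by blast
    have op: "open {h. rz_coeff h d = c}" for c
      unfolding open_rz_series_def
      by (intro ballI exI[of _ "max 0 (d + 1)"]) (auto simp: rz_ideal_def rz_coeff_minus)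
    show ?thesis
      using d op[of "rz_coeff f d"] op[of "rz_coeff g d"]
      by (intro exI[of _ "{h. rz_coeff h d = rz_coeff f d}"]
          exI[of _ "{h. rz_coeff h d = rz_coeff g d}"]) auto
  qed
qed

end


section \<open>Left divisibility classes and discrete degree maps\<close>

text \<open>In a noncommutative monoid the library relation \<open>a divides b\<close> is left divisibility
  \<open>b = a \<otimes> c\<close>; \<open>a \<sim> b\<close> is mutual left divisibility.\<close>

definition div_classes :: "('a, 'b) monoid_scheme \<Rightarrow> 'a set set" where
  "div_classes M = classes\<^bsub>division_rel M\<^esub>"

definition identity_class :: "('a, 'b) monoid_scheme \<Rightarrow> 'a set" where
  "identity_class M = class_of\<^bsub>division_rel M\<^esub> \<one>\<^bsub>M\<^esub>"

definition class_divides :: "('a, 'b) monoid_scheme \<Rightarrow> 'a set \<Rightarrow> 'a set \<Rightarrow> bool" where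
  "class_divides M U V \<longleftrightarrow> (\<exists>u\<in>U. \<exists>v\<in>V. u divides\<^bsub>M\<^esub> v)"

definition class_less :: "('a, 'b) monoid_scheme \<Rightarrow> 'a set \<Rightarrow> 'a set \<Rightarrow> bool" where
  "class_less M U V \<longleftrightarrow> (\<exists>u\<in>U. \<exists>v\<in>V. u divides\<^bsub>M\<^esub> v \<and> \<not> u \<sim>\<^bsub>M\<^esub> v)"

text \<open>Additivity of the degree makes it constant on every class, so \<open>the_elem\<close> picks that value.\<close>

definition class_deg :: "('a \<Rightarrow> real) \<Rightarrow> 'a set \<Rightarrow> real" where
  "class_deg deg U = the_elem (deg ` U)"

definition discrete_degree :: "('a, 'b) monoid_scheme \<Rightarrow> ('a \<Rightarrow> real) \<Rightarrow> bool" where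
  "discrete_degree M deg \<longleftrightarrow>
    (\<forall>u\<in>carrier M. 0 \<le> deg u) \<and>
    (\<forall>u\<in>carrier M. deg u = 0 \<longleftrightarrow> u \<sim>\<^bsub>M\<^esub> \<one>\<^bsub>M\<^esub>) \<and>
    (\<forall>u\<in>carrier M. \<forall>v\<in>carrier M. deg (u \<otimes>\<^bsub>M\<^esub> v) = deg u + deg v) \<and>
    (\<forall>r>0. finite {U \<in> div_classes M. class_deg deg U \<le> r})"


section \<open>Minimal common multiples and towers\<close>

definition cm :: "('a, 'b) monoid_scheme \<Rightarrow> 'a set set \<Rightarrow> 'a set set" where
  "cm M J = {U \<in> div_classes M. \<forall>V\<in>J. class_divides M V U}"

definition minimal_classes :: "('a, 'b) monoid_scheme \<Rightarrow> 'a set set \<Rightarrow> 'a set set" where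
  "minimal_classes M J = {U \<in> J. \<not> (\<exists>V\<in>J. class_less M V U)}"

definition mcm :: "('a, 'b) monoid_scheme \<Rightarrow> 'a set set \<Rightarrow> 'a set set" where
  "mcm M J = minimal_classes M (cm M J)"

text \<open>A tower \<open>(I\<^sub>0, J\<^sub>1, \<dots>, J\<^sub>n)\<close> is encoded as the pair of \<open>I\<^sub>0\<close> and the list
  \<open>[J\<^sub>1, \<dots>, J\<^sub>n]\<close>; thus \<open>J\<^sub>k\<close> is the list entry with index \<open>k - 1\<close>.\<close>

type_synonym 'a tower = "'a set set \<times> 'a set set list"

definition tower_J :: "'a tower \<Rightarrow> nat \<Rightarrow> 'a set set" where
  "tower_J T k = snd T ! (k - 1)"

definition tower_height :: "'a tower \<Rightarrow> nat" where
  "tower_height T = length (snd T)"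

definition tower_I :: "('a, 'b) monoid_scheme \<Rightarrow> 'a tower \<Rightarrow> nat \<Rightarrow> 'a set set" where
  "tower_I M T k = (if k = 0 then fst T else mcm M (tower_J T k))"

definition tower_top :: "('a, 'b) monoid_scheme \<Rightarrow> 'a tower \<Rightarrow> 'a set set" where
  "tower_top M T = tower_I M T (tower_height T)"

text \<open>Since \<open>card\<close> of an infinite set is 0, \<open>card J\<^sub>k > 1\<close> also demands that \<open>J\<^sub>k\<close> is finite.
  This excludes nothing: a class in \<open>mcm J\<^sub>k\<close> is a common multiple of \<open>J\<^sub>k\<close>, so under a discrete
  degree map \<open>J\<^sub>k\<close> has bounded degree and is finite.\<close>

definition is_tower :: "('a, 'b) monoid_scheme \<Rightarrow> 'a tower \<Rightarrow> bool" where
  "is_tower M T \<longleftrightarrow>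
    fst T \<subseteq> div_classes M - {identity_class M} \<and>
    (\<forall>k\<in>{1..tower_height T}. tower_J T k \<subseteq> div_classes M - {identity_class M}) \<and>
    fst T \<noteq> {} \<and> fst T = minimal_classes M (fst T) \<and>
    (\<forall>k\<in>{1..tower_height T}. tower_I M T k \<noteq> {}) \<and>
    (\<forall>k\<in>{1..tower_height T}. tower_J T k \<subseteq> tower_I M T (k - 1) \<and> card (tower_J T k) > 1)"

definition Tmcm :: "('a, 'b) monoid_scheme \<Rightarrow> 'a set set \<Rightarrow> 'a tower set" where
  "Tmcm M I = {T. is_tower M T \<and> fst T = I}"


section \<open>Growth and skew-growth functions\<close>

definition growth :: "('a, 'b) monoid_scheme \<Rightarrow> ('a \<Rightarrow> real) \<Rightarrow> rz_series" where
  "growth M deg = (\<Sum>\<^sub>\<infinity>U\<in>div_classes M. rz_monom (class_deg deg U))"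

definition ground :: "('a, 'b) monoid_scheme \<Rightarrow> 'a set set" where
  "ground M = minimal_classes M (div_classes M - {identity_class M})"

text \<open>The subtraction on \<open>nat\<close> does not truncate, as every \<open>J\<^sub>k\<close> of a tower has at least two
  elements.\<close>

definition tower_sign :: "'a tower \<Rightarrow> rz_series" where
  "tower_sign T = (-1) ^ ((\<Sum>k=1..tower_height T. card (tower_J T k)) - tower_height T + 1)"

definition tower_term :: "('a, 'b) monoid_scheme \<Rightarrow> ('a \<Rightarrow> real) \<Rightarrow> 'a tower \<Rightarrow> rz_series" where
  "tower_term M deg T =
    tower_sign T * (\<Sum>\<^sub>\<infinity>U\<in>tower_top M T. rz_monom (class_deg deg U))"

definition skew_growth :: "('a, 'b) monoid_scheme \<Rightarrow> ('a \<Rightarrow> real) \<Rightarrow> rz_series" where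
  "skew_growth M deg = 1 + (\<Sum>\<^sub>\<infinity>T\<in>Tmcm M (ground M). tower_term M deg T)"

text \<open>As \<open>infsum\<close> of a non-summable family is 0, convergence of all the series above is
  recorded separately.\<close>

definition growth_converges :: "('a, 'b) monoid_scheme \<Rightarrow> ('a \<Rightarrow> real) \<Rightarrow> bool" where
  "growth_converges M deg \<longleftrightarrow> (\<lambda>U. rz_monom (class_deg deg U)) summable_on div_classes M"

definition skew_growth_converges :: "('a, 'b) monoid_scheme \<Rightarrow> ('a \<Rightarrow> real) \<Rightarrow> bool" where
  "skew_growth_converges M deg \<longleftrightarrow>
    (\<forall>T\<in>Tmcm M (ground M). (\<lambda>U. rz_monom (class_deg deg U)) summable_on tower_top M T) \<and>
    tower_term M deg summable_on Tmcm M (ground M)"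

end

(*
  By left cancellation, U |-> VU is a bijection from the classes onto the right multiples of V, so
  the coefficient of t^d in t^(deg V) P counts the classes of degree d divisible by V. Writing
  N = sum_V m(V) t^(deg V), the formula becomes the statement that m is the Moebius function
  m(1, _) of the divisibility poset: sum_(V | U) m(V) = [U = 1].
  For U different from 1 this says that the towers with ground I_0, weighted by
  (-1)^(sum_k (#J_k - 1)) times the number of elements of their top dividing U, add up to 1. More
  generally this holds for every antichain I with A = {V in I. V | U} nonempty: splitting off the
  first set J of a tower, which must be contained in A, and using induction for mcm(J), the sum is
  #A + sum_(J subset A, #J > 1) (-1)^(#J - 1) = 1.
*)

theory Submission
  imports Defs
begin

section \<open>Summable families of series\<close>

lemma rz_coeff_0 [simp]: "rz_coeff 0 d = 0"
  by (simp add: zero_rz_series.rep_eq)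

lemma rz_coeff_add: "rz_coeff (f + g) d = rz_coeff f d + rz_coeff g d"
  by (simp add: plus_rz_series.rep_eq)

lemma rz_coeff_1: "rz_coeff 1 d = (if d = 0 then 1 else 0)"
  by (simp add: one_rz_series_def rz_monom.rep_eq)

lemma rz_coeff_sum: "rz_coeff (\<Sum>x\<in>A. f x) d = (\<Sum>x\<in>A. rz_coeff (f x) d)"
  by (induction A rule: infinite_finite_induct) (auto simp: rz_coeff_add)

text \<open>\<open>tower_sign\<close> lives in the ring of series; this turns it into an integer
  sign on coefficients.\<close>

lemma rz_coeff_neg1_power_mult: "rz_coeff ((-1) ^ k * f) d = (-1) ^ k * rz_coeff f d"
proof (induction k)
  case (Suc k)
  have "rz_coeff ((-1) ^ Suc k * f) d = rz_coeff (- ((-1) ^ k * f)) d" by simp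
  then show ?case using Suc by (simp add: uminus_rz_series.rep_eq)
qed simp

text \<open>Up to each \<open>r\<close> only finitely many members matter, each with finitely many
  exponents there, so the coefficientwise sum \<open>s\<close> is a series. Partial sums over finite
  sets containing these members agree with \<open>s\<close> below \<open>r\<close>, which is
  closeness in the topology.\<close>

lemma rz_has_sum:
  fixes f :: "'i \<Rightarrow> rz_series"
  assumes fin: "\<And>r. finite {x \<in> A. \<exists>d\<le>r. rz_coeff (f x) d \<noteq> 0}"
  obtains S where "(f has_sum S) A"
    and "\<And>d B. finite B \<Longrightarrow> {x \<in> A. rz_coeff (f x) d \<noteq> 0} \<subseteq> B \<Longrightarrow> B \<subseteq> A \<Longrightarrow>
      rz_coeff S d = (\<Sum>x\<in>B. rz_coeff (f x) d)"
proof -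
  define X where "X d = {x \<in> A. rz_coeff (f x) d \<noteq> 0}" for d
  define s where "s d = (\<Sum>x\<in>X d. rz_coeff (f x) d)" for d
  have finX: "finite (X d)" for d
    by (rule finite_subset[OF _ fin[of d]]) (auto simp: X_def)
  have "finite {d. d \<le> r \<and> s d \<noteq> 0}" for r
  proof (rule finite_subset)
    show "{d. d \<le> r \<and> s d \<noteq> 0}
        \<subseteq> (\<Union>x\<in>{x \<in> A. \<exists>d\<le>r. rz_coeff (f x) d \<noteq> 0}. {d. d \<le> r \<and> rz_coeff (f x) d \<noteq> 0})"
    proof clarify
      fix d assume "d \<le> r" "s d \<noteq> 0"
      then obtain x where "x \<in> X d" unfolding s_def by (meson sum.not_neutral_contains_not_neutral)
      then show "d \<in> (\<Union>x\<in>{x \<in> A. \<exists>d\<le>r. rz_coeff (f x) d \<noteq> 0}. {d. d \<le> r \<and> rz_coeff (f x) d \<noteq> 0})"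
        using \<open>d \<le> r\<close> by (auto simp: X_def)
    qed
    show "finite (\<Union>x\<in>{x \<in> A. \<exists>d\<le>r. rz_coeff (f x) d \<noteq> 0}. {d. d \<le> r \<and> rz_coeff (f x) d \<noteq> 0})"
      by (intro finite_UN_I fin finite_rz_support)
  qed
  moreover have "s d = 0" if "d < 0" for d
    unfolding s_def by (rule sum.neutral) (simp add: rz_coeff_neg[OF that])
  ultimately have coeff: "rz_coeff (Abs_rz_series s) d = s d" for d
    by (simp add: Abs_rz_series_inverse)
  have s_eq: "s d = (\<Sum>x\<in>B. rz_coeff (f x) d)" if "finite B" "X d \<subseteq> B" "B \<subseteq> A" for d B
    unfolding s_def using that by (intro sum.mono_neutral_left) (auto simp: X_def)
  have "(f has_sum Abs_rz_series s) A"
    unfolding has_sum_def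
  proof (rule topological_tendstoI)
    fix U assume "open U" "Abs_rz_series s \<in> U"
    then obtain r where r: "{g. g - Abs_rz_series s \<in> rz_ideal r} \<subseteq> U"
      unfolding open_rz_series_def by blast
    show "\<forall>\<^sub>F F in finite_subsets_at_top A. sum f F \<in> U"
      unfolding eventually_finite_subsets_at_top
    proof (intro exI conjI allI impI)
      show "finite {x \<in> A. \<exists>d\<le>r. rz_coeff (f x) d \<noteq> 0}" by (rule fin)
      fix F assume F: "finite F \<and> {x \<in> A. \<exists>d\<le>r. rz_coeff (f x) d \<noteq> 0} \<subseteq> F \<and> F \<subseteq> A"
      have "rz_coeff (sum f F) d = s d" if "d < r" for d
        unfolding rz_coeff_sum
      proof (rule s_eq[symmetric])
        show "X d \<subseteq> F" using F less_imp_le[OF that] unfolding X_def by blast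
      qed (use F in auto)
      then have "sum f F - Abs_rz_series s \<in> rz_ideal r"
        by (simp add: rz_ideal_def rz_coeff_minus coeff)
      then show "sum f F \<in> U" using r by blast
    qed auto
  qed
  then show thesis
  proof (rule that)
    fix d B assume "finite B" "{x \<in> A. rz_coeff (f x) d \<noteq> 0} \<subseteq> B" "B \<subseteq> A"
    then show "rz_coeff (Abs_rz_series s) d = (\<Sum>x\<in>B. rz_coeff (f x) d)"
      unfolding coeff by (intro s_eq) (simp_all add: X_def)
  qed
qed

lemma rz_summable_on:
  fixes f :: "'i \<Rightarrow> rz_series"
  assumes "\<And>r. finite {x \<in> A. \<exists>d\<le>r. rz_coeff (f x) d \<noteq> 0}"
  shows "f summable_on A"
  by (rule rz_has_sum[OF assms]) (rule has_sum_imp_summable)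

text \<open>Limits are unique in a Hausdorff space, so \<open>infsum\<close> is the sum just built.
  \<open>B\<close> may be any finite subset of \<open>A\<close> with all contributing members, so
  each application can choose a convenient index set.\<close>

lemma rz_coeff_infsum:
  fixes f :: "'i \<Rightarrow> rz_series"
  assumes "\<And>r. finite {x \<in> A. \<exists>d\<le>r. rz_coeff (f x) d \<noteq> 0}"
    and "finite B" "{x \<in> A. rz_coeff (f x) d \<noteq> 0} \<subseteq> B" "B \<subseteq> A"
  shows "rz_coeff (infsum f A) d = (\<Sum>x\<in>B. rz_coeff (f x) d)"
proof (rule rz_has_sum[OF assms(1)])
  fix S
  assume S: "(f has_sum S) A" and coeff: "\<And>d B. finite B \<Longrightarrow>
    {x \<in> A. rz_coeff (f x) d \<noteq> 0} \<subseteq> B \<Longrightarrow> B \<subseteq> A \<Longrightarrow> rz_coeff S d = (\<Sum>x\<in>B. rz_coeff (f x) d)"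
  show ?thesis
    unfolding infsumI[OF S] by (rule coeff[OF assms(2-4)])
qed

section \<open>Alternating sums over the subsets of a finite set\<close>

lemma sum_alternating_subsets:
  assumes "finite A" "A \<noteq> {}"
  shows "(\<Sum>J | J \<subseteq> A. (-1) ^ card J) = (0::int)"
  \<comment> \<open>With lower set \<open>{}\<close>, the counting lemma says that a nonempty finite
    set has as many even as odd subsets.\<close>
  by (rule sum_alternating_cancels)
    (use assms card_subsupersets_even_odd[of A "{}"] in auto)

text \<open>In the vanishing alternating sum over all subsets, the empty set contributes 1 and the
  singletons \<open>- card A\<close>; solving for the larger subsets and reversing their sign gives
  the identity. It closes the induction over towers.\<close>

lemma sum_alternating_large_subsets:
  assumes A: "finite A" "A \<noteq> {}"
  shows "int (card A) + (\<Sum>J | J \<subseteq> A \<and> 1 < card J. (-1) ^ (card J - 1)) = 1"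
proof -
  let ?L = "{J. J \<subseteq> A \<and> 1 < card J}" and ?S = "(\<lambda>a. {a}) ` A"
  have "{J. J \<subseteq> A} = insert {} (?S \<union> ?L)"
  proof (intro equalityI subsetI)
    fix J assume "J \<in> {J. J \<subseteq> A}"
    then have J: "J \<subseteq> A" "finite J" using A(1) finite_subset by auto
    consider "card J = 0" | "card J = 1" | "1 < card J" by linarith
    then show "J \<in> insert {} (?S \<union> ?L)"
      by cases (use J in \<open>auto simp: card_1_singleton_iff\<close>)
  qed auto
  moreover have "{} \<notin> ?S \<union> ?L" "?S \<inter> ?L = {}" by auto
  moreover have "finite ?S" "finite ?L" using A(1) by auto
  ultimately have "(\<Sum>J | J \<subseteq> A. (-1) ^ card J)
      = 1 + ((\<Sum>J\<in>?S. (-1) ^ card J) + (\<Sum>J\<in>?L. (-1) ^ card J :: int))"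
    by (simp add: sum.union_disjoint)
  moreover have "(\<Sum>J\<in>?S. (-1) ^ card J) = - int (card A)"
    by (subst sum.reindex) auto
  moreover have "(\<Sum>J\<in>?L. (-1) ^ card J) = - (\<Sum>J\<in>?L. (-1) ^ (card J - 1) :: int)"
    unfolding sum_negf[symmetric]
  proof (rule sum.cong)
    fix J assume "J \<in> ?L"
    then obtain n where "card J = Suc n" by (cases "card J") auto
    then show "(-1) ^ card J = - ((-1) ^ (card J - 1) :: int)" by simp
  qed simp
  ultimately show ?thesis using sum_alternating_subsets[OF A] by linarith
qed

section \<open>The poset of divisibility classes\<close>

locale graded_cancel_monoid = monoid_cancel G for G (structure) +
  fixes deg :: "'a \<Rightarrow> real"
  assumes discrete: "discrete_degree G deg"
begin

abbreviation cl :: "'a \<Rightarrow> 'a set" where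
  "cl u \<equiv> class_of\<^bsub>division_rel G\<^esub> u"

abbreviation class_le :: "'a set \<Rightarrow> 'a set \<Rightarrow> bool" (infix \<open>\<preceq>\<close> 50) where
  "U \<preceq> V \<equiv> class_divides G U V"

abbreviation cdeg :: "'a set \<Rightarrow> real" where
  "cdeg \<equiv> class_deg deg"

abbreviation classes_upto :: "'a set \<Rightarrow> 'a set set" where
  "classes_upto U \<equiv> {V \<in> div_classes G. V \<preceq> U}"

lemma cl_eq_iff: "u \<in> carrier G \<Longrightarrow> v \<in> carrier G \<Longrightarrow> cl u = cl v \<longleftrightarrow> u \<sim> v"
  unfolding eq_class_of_def by (auto intro: associated_sym associated_trans)

lemma div_classes_eq: "div_classes G = cl ` carrier G"
  by (auto simp: div_classes_def eq_classes_def)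

lemma div_classesE:
  assumes "U \<in> div_classes G"
  obtains u where "u \<in> carrier G" "U = cl u"
  using assms by (auto simp: div_classes_eq)

lemma identity_class_eq: "identity_class G = cl \<one>"
  by (simp add: identity_class_def)

lemma identity_class_in [simp]: "identity_class G \<in> div_classes G"
  by (simp add: identity_class_eq div_classes_eq)

lemma class_le_cl:
  assumes "u \<in> carrier G" "v \<in> carrier G"
  shows "cl u \<preceq> cl v \<longleftrightarrow> u divides v"
proof
  assume "cl u \<preceq> cl v"
  then obtain x y where "x \<in> carrier G" "y \<in> carrier G" "u \<sim> x" "v \<sim> y" "x divides y"
    by (auto simp: class_divides_def eq_class_of_def)
  then show "u divides v"
    using assms unfolding associated_def by (meson divides_trans)
next
  assume "u divides v"
  then show "cl u \<preceq> cl v"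
    using assms unfolding class_divides_def eq_class_of_def by force
qed

lemma class_le_refl [simp]: "U \<in> div_classes G \<Longrightarrow> U \<preceq> U"
  by (auto elim!: div_classesE simp: class_le_cl)

lemma class_le_trans:
  assumes "U \<preceq> V" "V \<preceq> W" "U \<in> div_classes G" "V \<in> div_classes G" "W \<in> div_classes G"
  shows "U \<preceq> W"
proof -
  obtain u v w where "u \<in> carrier G" "U = cl u" "v \<in> carrier G" "V = cl v" "w \<in> carrier G" "W = cl w"
    using assms by (meson div_classesE)
  then show ?thesis using assms(1,2) by (auto simp: class_le_cl intro: divides_trans)
qed

lemma class_le_antisym:
  assumes "U \<preceq> V" "V \<preceq> U" "U \<in> div_classes G" "V \<in> div_classes G"
  shows "U = V"
proof -
  obtain u v where "u \<in> carrier G" "U = cl u" "v \<in> carrier G" "V = cl v"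
    using assms by (meson div_classesE)
  then show ?thesis using assms(1,2) by (simp add: class_le_cl cl_eq_iff associatedI)
qed

text \<open>Representatives of two classes are associated exactly when the classes coincide, so the
  existential choice in \<open>class_less\<close> is harmless and the relation is the strict part of
  the order.\<close>

lemma class_less_iff:
  assumes "U \<in> div_classes G" "V \<in> div_classes G"
  shows "class_less G U V \<longleftrightarrow> U \<preceq> V \<and> U \<noteq> V"
proof -
  obtain u v where u: "u \<in> carrier G" "U = cl u" and v: "v \<in> carrier G" "V = cl v"
    using assms by (meson div_classesE)
  have cl: "cl x = U" if "x \<in> U" "U \<in> div_classes G" for x U
  proof -
    obtain u where "u \<in> carrier G" "U = cl u" using \<open>U \<in> div_classes G\<close> by (rule div_classesE)
    then show ?thesis using \<open>x \<in> U\<close> cl_eq_iff[of x u] by (simp add: eq_class_of_def associated_sym)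
  qed
  have "x \<sim> y \<longleftrightarrow> U = V" if "x \<in> U" "y \<in> V" for x y
  proof -
    have "x \<in> carrier G" "y \<in> carrier G" using that u v by (simp_all add: eq_class_of_def)
    then show ?thesis using cl_eq_iff[of x y] cl[OF that(1) assms(1)] cl[OF that(2) assms(2)] by simp
  qed
  then show ?thesis unfolding class_less_def class_divides_def by blast
qed

lemma identity_class_le: "U \<in> div_classes G \<Longrightarrow> identity_class G \<preceq> U"
  by (elim div_classesE) (simp add: identity_class_eq class_le_cl factor_def)

section \<open>The degree on classes, and its finiteness properties\<close>

lemma deg_nonneg: "u \<in> carrier G \<Longrightarrow> 0 \<le> deg u"
  and deg_eq_0_iff: "u \<in> carrier G \<Longrightarrow> deg u = 0 \<longleftrightarrow> u \<sim> \<one>"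
  and deg_mult: "u \<in> carrier G \<Longrightarrow> v \<in> carrier G \<Longrightarrow> deg (u \<otimes> v) = deg u + deg v"
  using discrete unfolding discrete_degree_def by blast+

lemma deg_divides: "u \<in> carrier G \<Longrightarrow> u divides v \<Longrightarrow> deg u \<le> deg v"
  by (elim dividesE) (simp add: deg_mult deg_nonneg)

text \<open>Members of a class divide each other and \<open>deg\<close> is monotone under
  divisibility, so \<open>the_elem\<close> is applied to a singleton.\<close>

lemma cdeg_cl: "u \<in> carrier G \<Longrightarrow> cdeg (cl u) = deg u"
proof -
  assume u: "u \<in> carrier G"
  have "deg x = deg u" if "x \<in> cl u" for x
  proof -
    have "x \<in> carrier G" "u divides x" "x divides u"
      using that by (simp_all add: eq_class_of_def associated_def)
    then show ?thesis using deg_divides[of u x] deg_divides[of x u] u by simp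
  qed
  moreover have "u \<in> cl u" using u by (simp add: eq_class_of_def)
  ultimately have "deg ` cl u = {deg u}" by (metis image_is_empty image_subsetI singletonI empty_iff subset_singletonD)
  then show ?thesis by (simp add: class_deg_def)
qed

lemma cdeg_nonneg: "U \<in> div_classes G \<Longrightarrow> 0 \<le> cdeg U"
  by (auto elim!: div_classesE simp: cdeg_cl deg_nonneg)

lemma cdeg_eq_0_iff: "U \<in> div_classes G \<Longrightarrow> cdeg U = 0 \<longleftrightarrow> U = identity_class G"
  by (elim div_classesE) (simp add: cdeg_cl deg_eq_0_iff identity_class_eq cl_eq_iff)

lemma cdeg_mono: "U \<preceq> V \<Longrightarrow> U \<in> div_classes G \<Longrightarrow> V \<in> div_classes G \<Longrightarrow> cdeg U \<le> cdeg V"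
  by (auto elim!: div_classesE simp: cdeg_cl class_le_cl deg_divides)

lemma finite_cdeg_le: "finite {U \<in> div_classes G. cdeg U \<le> r}"
proof (rule finite_subset)
  have "\<forall>r>0. finite {U \<in> div_classes G. cdeg U \<le> r}"
    using discrete unfolding discrete_degree_def by blast
  \<comment> \<open>The axiom covers only positive bounds; \<open>max 1 r\<close> reduces every real
    \<open>r\<close> to such a bound.\<close>
  then show "finite {U \<in> div_classes G. cdeg U \<le> max 1 r}" by simp
qed auto

lemma finite_cdeg_eq: "finite {U \<in> div_classes G. cdeg U = d}"
  by (rule finite_subset[OF _ finite_cdeg_le[of d]]) auto

lemma finite_classes_upto: "U \<in> div_classes G \<Longrightarrow> finite (classes_upto U)"
  by (rule finite_subset[OF _ finite_cdeg_le[of "cdeg U"]]) (auto intro: cdeg_mono)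

text \<open>Left multiplication by a representative \<open>v\<close> of \<open>V\<close> raises
  degrees by \<open>cdeg V\<close> and induces a bijection from all classes onto the multiples of
  \<open>V\<close>.\<close>

lemma card_multiples:
  assumes V: "V \<in> div_classes G"
  shows "card {U \<in> div_classes G. cdeg U = d \<and> V \<preceq> U} = card {X \<in> div_classes G. cdeg X = d - cdeg V}"
proof -
  obtain v where v: "v \<in> carrier G" "V = cl v" using V by (rule div_classesE)
  define rep where "rep X = (SOME x. x \<in> carrier G \<and> X = cl x)" for X
  have rep: "rep X \<in> carrier G" "cl (rep X) = X" if "X \<in> div_classes G" for X
  proof -
    have "\<exists>x. x \<in> carrier G \<and> X = cl x" using that unfolding div_classes_eq by blast
    then have "rep X \<in> carrier G \<and> X = cl (rep X)" unfolding rep_def by (rule someI_ex)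
    then show "rep X \<in> carrier G" "cl (rep X) = X" by simp_all
  qed
  \<comment> \<open>From left to right this is left cancellation and gives injectivity; from right
    to left it makes the class of the product independent of the chosen \<open>rep\<close>, as
    surjectivity needs.\<close>
  have cancel: "v \<otimes> x \<sim> v \<otimes> y \<longleftrightarrow> x \<sim> y" if "x \<in> carrier G" "y \<in> carrier G" for x y
    using that v by (simp add: associated_def)
  have "bij_betw (\<lambda>X. cl (v \<otimes> rep X)) {X \<in> div_classes G. cdeg X = d - cdeg V}
      {U \<in> div_classes G. cdeg U = d \<and> V \<preceq> U}"
    unfolding bij_betw_def
  proof (intro conjI equalityI subsetI)
    show "inj_on (\<lambda>X. cl (v \<otimes> rep X)) {X \<in> div_classes G. cdeg X = d - cdeg V}"
    proof (rule inj_onI)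
      fix X Y assume "X \<in> {X \<in> div_classes G. cdeg X = d - cdeg V}"
        "Y \<in> {X \<in> div_classes G. cdeg X = d - cdeg V}" and eq: "cl (v \<otimes> rep X) = cl (v \<otimes> rep Y)"
      then have XY: "X \<in> div_classes G" "Y \<in> div_classes G" by simp_all
      then have "rep X \<sim> rep Y"
        using eq rep(1) v by (simp add: cl_eq_iff cancel)
      then have "cl (rep X) = cl (rep Y)" using rep(1) XY by (simp add: cl_eq_iff)
      then show "X = Y" using rep(2) XY by simp
    qed
  next
    fix U assume "U \<in> (\<lambda>X. cl (v \<otimes> rep X)) ` {X \<in> div_classes G. cdeg X = d - cdeg V}"
    then obtain X where X: "X \<in> div_classes G" "cdeg X = d - cdeg V" "U = cl (v \<otimes> rep X)" by auto
    have "cdeg X = deg (rep X)" using cdeg_cl[OF rep(1)[OF X(1)]] rep(2)[OF X(1)] by simp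
    then show "U \<in> {U \<in> div_classes G. cdeg U = d \<and> V \<preceq> U}"
      using X v rep(1)[OF X(1)] by (simp add: div_classes_eq cdeg_cl deg_mult class_le_cl divides_prod_r)
  next
    fix U assume "U \<in> {U \<in> div_classes G. cdeg U = d \<and> V \<preceq> U}"
    then have U: "U \<in> div_classes G" "cdeg U = d" "V \<preceq> U" by simp_all
    obtain u where "u \<in> carrier G" "U = cl u" using U(1) by (rule div_classesE)
    with U v have u: "u \<in> carrier G" "U = cl u" "deg u = d" "v divides u"
      by (simp_all add: class_le_cl cdeg_cl)
    obtain x where x: "x \<in> carrier G" "u = v \<otimes> x" using u(4) by (rule dividesE)
    have X: "cl x \<in> div_classes G" using x by (auto simp: div_classes_eq)
    have "rep (cl x) \<sim> x" using rep[OF X] x cl_eq_iff[of "rep (cl x)" x] by simp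
    then have "U = cl (v \<otimes> rep (cl x))"
      using u x v rep[OF X] by (simp add: cl_eq_iff cancel associated_sym)
    moreover have "cdeg (cl x) = d - cdeg V" using x u v by (simp add: cdeg_cl deg_mult)
    ultimately show "U \<in> (\<lambda>X. cl (v \<otimes> rep X)) ` {X \<in> div_classes G. cdeg X = d - cdeg V}"
      using X by auto
  qed
  from bij_betw_same_card[OF this] show ?thesis by simp
qed

section \<open>Towers\<close>

lemma minimal_classes_subset: "minimal_classes G J \<subseteq> J"
  by (auto simp: minimal_classes_def)

lemma minimal_classes_idem: "minimal_classes G (minimal_classes G J) = minimal_classes G J"
  by (auto simp: minimal_classes_def)

lemma minimal_classes_antichain:
  assumes "I \<subseteq> div_classes G" "I = minimal_classes G I" "V \<in> I" "W \<in> I" "V \<preceq> W"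
  shows "V = W"
proof -
  have "W \<in> minimal_classes G I" using assms(2,4) by metis
  then have "\<not> class_less G V W" using assms(3) by (simp add: minimal_classes_def)
  then show ?thesis using assms class_less_iff by blast
qed

text \<open>A class has only finitely many divisors. Among the members of \<open>J\<close> below
  \<open>U\<close>, one with the fewest divisors is minimal, since a strictly smaller class has
  strictly fewer.\<close>

lemma ex_minimal_class_below:
  assumes J: "J \<subseteq> div_classes G" and U: "U \<in> J"
  shows "\<exists>V\<in>minimal_classes G J. V \<preceq> U"
proof -
  have UC: "U \<in> div_classes G" using assms by auto
  have fin: "finite (J \<inter> classes_upto U)" using finite_classes_upto[OF UC] by auto
  obtain V where V: "V \<in> J" "V \<preceq> U" "V \<in> div_classes G"
    and min: "\<And>W. W \<in> J \<Longrightarrow> W \<preceq> U \<Longrightarrow> card (classes_upto V) \<le> card (classes_upto W)"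
    using ex_has_least_nat[of "\<lambda>V. V \<in> J \<and> V \<preceq> U" U "\<lambda>V. card (classes_upto V)"] U UC J by auto
  have False if "W \<in> J" "class_less G W V" for W
  proof -
    have W: "W \<in> div_classes G" "W \<preceq> V" "W \<noteq> V"
      using that J V class_less_iff by auto
    have "classes_upto W \<subset> classes_upto V"
      using W V by (auto intro: class_le_trans dest: class_le_antisym)
    then have "card (classes_upto W) < card (classes_upto V)"
      using V finite_classes_upto by (simp add: psubset_card_mono)
    moreover have "W \<preceq> U" using W V UC class_le_trans by blast
    ultimately show False using min that by (meson leD)
  qed
  then show ?thesis using V by (auto simp: minimal_classes_def)
qed

section \<open>Towers as a recursion on lists\<close>

text \<open>These are the conditions that \<open>is_tower\<close> puts on the ground. They are
  inherited by the nonempty sets \<open>mcm G J\<close> inside a tower, so that a tower without its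
  first \<open>J\<close> is again a tower.\<close>

definition tower_base :: "'a set set \<Rightarrow> bool" where
  "tower_base I \<longleftrightarrow> I \<subseteq> div_classes G - {identity_class G} \<and> I \<noteq> {} \<and> I = minimal_classes G I"

lemma tower_top_Nil: "tower_top G (I, []) = I"
  by (simp add: tower_top_def tower_height_def tower_I_def)

lemma tower_top_Cons: "tower_top G (I, J # Js) = tower_top G (mcm G J, Js)"
  by (cases Js) (auto simp: tower_top_def tower_height_def tower_I_def tower_J_def)

lemma is_tower_Nil: "is_tower G (I, []) \<longleftrightarrow> tower_base I"
  unfolding is_tower_def tower_base_def by (simp add: tower_height_def)

lemma mcm_subset: "mcm G J \<subseteq> div_classes G"
  by (auto simp: mcm_def minimal_classes_def cm_def)

lemma mcm_multiple: "V \<in> mcm G J \<Longrightarrow> W \<in> J \<Longrightarrow> W \<preceq> V"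
  by (auto simp: mcm_def minimal_classes_def cm_def)

text \<open>The identity class cannot lie in \<open>mcm G J\<close>: it would be a multiple of a
  member of \<open>J\<close>, but its only divisor is itself, which is not in
  \<open>I\<close>.\<close>

lemma tower_base_mcm:
  assumes "tower_base I" "J \<subseteq> I" "J \<noteq> {}" "mcm G J \<noteq> {}"
  shows "tower_base (mcm G J)"
proof -
  obtain W where W: "W \<in> J" "W \<in> div_classes G" "W \<noteq> identity_class G"
    using assms(1-3) unfolding tower_base_def by blast
  have "identity_class G \<notin> mcm G J"
    using mcm_multiple[OF _ W(1), of "identity_class G"] identity_class_le W class_le_antisym
    by (metis identity_class_in)
  moreover have "mcm G J = minimal_classes G (mcm G J)"
    by (simp add: mcm_def minimal_classes_idem)
  ultimately show ?thesis
    using assms(4) mcm_subset unfolding tower_base_def by blast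
qed

text \<open>Level \<open>k + 1\<close> of \<open>(I, J # Js)\<close> is level \<open>k\<close> of
  \<open>(mcm G J, Js)\<close>. This replaces the indexed definition by a recursion in which the
  ground changes at every step.\<close>

lemma is_tower_Cons:
  "is_tower G (I, J # Js) \<longleftrightarrow> tower_base I \<and> J \<subseteq> I \<and> 1 < card J \<and> is_tower G (mcm G J, Js)"
proof -
  define Q where "Q I Js k \<longleftrightarrow> tower_I G (I, Js) k \<noteq> {} \<and> tower_J (I, Js) k \<subseteq> div_classes G - {identity_class G}
      \<and> tower_J (I, Js) k \<subseteq> tower_I G (I, Js) (k - 1) \<and> 1 < card (tower_J (I, Js) k)" for I Js k
  have is_tower: "is_tower G (I, Js) \<longleftrightarrow> tower_base I \<and> (\<forall>k\<in>{1..length Js}. Q I Js k)" for I Js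
    unfolding is_tower_def tower_base_def Q_def tower_height_def fst_conv snd_conv by blast
  have split: "(\<forall>k\<in>{1..Suc n}. P k) \<longleftrightarrow> P 1 \<and> (\<forall>k\<in>{1..n}. P (Suc k))" for P n
    by (auto simp: atLeastAtMost_insertL[symmetric] image_Suc_atLeastAtMost[symmetric]
        simp del: image_Suc_atLeastAtMost)
  \<comment> \<open>At \<open>k = 0\<close> truncated subtraction would read entry 0 of both lists,
    hence the restriction to \<open>1 \<le> k\<close>.\<close>
  have J: "tower_J (I, J # Js) (Suc k) = tower_J (mcm G J, Js) k" if "1 \<le> k" for k
    using that by (auto simp: tower_J_def nth_Cons')
  have I: "tower_I G (I, J # Js) (Suc k) = tower_I G (mcm G J, Js) k" for k
    by (cases k) (auto simp: tower_I_def tower_J_def)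
  have Q_Suc: "Q I (J # Js) (Suc k) = Q (mcm G J) Js k" if "k \<in> {1..length Js}" for k
    using that I[of "k - 1"] by (simp add: Q_def I J)
  have Q_1: "Q I (J # Js) 1 \<longleftrightarrow> mcm G J \<noteq> {} \<and> J \<subseteq> div_classes G - {identity_class G} \<and> J \<subseteq> I \<and> 1 < card J"
    by (simp add: Q_def tower_I_def tower_J_def)
  \<comment> \<open>The indexed conditions only ask that \<open>mcm G J\<close> be nonempty; the
    other requirements on the ground of the tail follow.\<close>
  have base: "tower_base (mcm G J) \<longleftrightarrow> mcm G J \<noteq> {}" if "tower_base I" "J \<subseteq> I" "1 < card J"
  proof -
    have "J \<noteq> {}" using that(3) by auto
    then show ?thesis using tower_base_mcm[OF that(1,2)] unfolding tower_base_def by blast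
  qed
  have sub: "I \<subseteq> div_classes G - {identity_class G}" if "tower_base I"
    using that unfolding tower_base_def by blast
  have "is_tower G (I, J # Js) \<longleftrightarrow> tower_base I \<and> Q I (J # Js) 1 \<and> (\<forall>k\<in>{1..length Js}. Q (mcm G J) Js k)"
    unfolding is_tower list.size(4) add.right_neutral add_Suc_right using split Q_Suc by simp
  then show ?thesis
    unfolding is_tower Q_1 using base sub by blast
qed

lemma is_tower_base: "is_tower G (I, Js) \<Longrightarrow> tower_base I"
  unfolding is_tower_def tower_base_def fst_conv by blast

lemma tower_baseD: "tower_base I \<Longrightarrow> V \<in> I \<Longrightarrow> V \<in> div_classes G \<and> V \<noteq> identity_class G"
  unfolding tower_base_def by blast

lemma tower_base_antichain: "tower_base I \<Longrightarrow> V \<in> I \<Longrightarrow> W \<in> I \<Longrightarrow> V \<preceq> W \<Longrightarrow> V = W"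
  by (rule minimal_classes_antichain[of I]) (unfold tower_base_def, blast+)

text \<open>Every \<open>J\<close> is nonempty and each member of \<open>mcm G J\<close> is a
  multiple of all of \<open>J\<close>, so divisibility by some class of the ground passes up through
  the levels.\<close>

lemma tower_top_above:
  assumes "is_tower G (I, Js)" "V \<in> tower_top G (I, Js)"
  shows "V \<in> div_classes G \<and> V \<noteq> identity_class G \<and> (\<exists>W\<in>I. W \<preceq> V)"
  using assms
proof (induction Js arbitrary: I)
  case Nil
  then have "tower_base I" "V \<in> I" by (simp_all add: is_tower_Nil tower_top_Nil)
  then show ?case using tower_baseD class_le_refl by blast
next
  case (Cons J Js)
  then have J: "tower_base I" "J \<subseteq> I" "1 < card J" and T: "is_tower G (mcm G J, Js)"
    by (simp_all add: is_tower_Cons)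
  obtain W where W: "W \<in> mcm G J" "W \<preceq> V" "V \<in> div_classes G" "V \<noteq> identity_class G"
    using Cons.IH[OF T] Cons.prems(2) by (auto simp: tower_top_Cons)
  obtain W' where W': "W' \<in> J" using J(3) by fastforce
  have "W' \<preceq> V"
    using class_le_trans[OF mcm_multiple[OF W(1) W'] W(2)] W W' J mcm_subset tower_baseD by blast
  then show ?case using W W' J by blast
qed

text \<open>The sign as an integer, multiplicative along the list. The extra 1 in the exponent of
  \<open>tower_sign\<close> is left out, so the two differ by a factor -1 on towers.\<close>

definition tower_sgn :: "'a set set list \<Rightarrow> int" where
  "tower_sgn Js = (-1) ^ (\<Sum>J\<leftarrow>Js. card J - 1)"

lemma tower_sgn_Nil [simp]: "tower_sgn [] = 1"
  and tower_sgn_Cons: "tower_sgn (J # Js) = (-1) ^ (card J - 1) * tower_sgn Js"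
  by (simp_all add: tower_sgn_def power_add)

lemma is_tower_card: "is_tower G (I, Js) \<Longrightarrow> J \<in> set Js \<Longrightarrow> 1 < card J"
  by (induction Js arbitrary: I) (auto simp: is_tower_Cons)

text \<open>Each \<open>J\<close> of a tower has more than one element, so subtracting the height
  amounts to subtracting 1 from every summand without truncation.\<close>

lemma tower_sign_eq:
  assumes "is_tower G (I, Js)"
  shows "tower_sign (I, Js) = (-1) ^ Suc (\<Sum>J\<leftarrow>Js. card J - 1)"
proof -
  have "(\<Sum>J\<leftarrow>Js. card J) = (\<Sum>J\<leftarrow>Js. card J - 1) + length Js" if "\<forall>J\<in>set Js. 1 < card J" for Js :: "'a set set list"
    using that by (induction Js) auto
  moreover have "\<forall>J\<in>set Js. 1 < card J" using is_tower_card[OF assms] by blast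
  moreover have "(\<Sum>k=1..length Js. card (Js ! (k - 1))) = (\<Sum>J\<leftarrow>Js. card J)"
    by (simp add: sum_list_sum_nth sum.atLeast1_atMost_eq atLeast0LessThan)
  ultimately show ?thesis
    by (simp add: tower_sign_def tower_height_def tower_J_def)
qed

section \<open>Signed counting of towers whose top meets the divisors of a class\<close>

text \<open>The towers that contribute to a sum over the divisors of \<open>U\<close>. Only the
  lists are stored and the ground is a parameter, because the recursion changes the ground.\<close>

definition towers_below :: "'a set set \<Rightarrow> 'a set \<Rightarrow> 'a set set list set" where
  "towers_below I U = {Js. is_tower G (I, Js) \<and> tower_top G (I, Js) \<inter> classes_upto U \<noteq> {}}"

lemma towers_below_ground:
  assumes "U \<in> div_classes G" "Js \<in> towers_below I U"
  shows "I \<inter> classes_upto U \<noteq> {}"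
proof -
  obtain V where V: "V \<in> tower_top G (I, Js)" "V \<in> classes_upto U" and T: "is_tower G (I, Js)"
    using assms(2) by (auto simp: towers_below_def)
  obtain W where W: "W \<in> I" "W \<preceq> V" using tower_top_above[OF T V(1)] by blast
  have "W \<in> div_classes G" using W is_tower_base[OF T] tower_baseD by blast
  then show ?thesis using W V(2) assms(1) class_le_trans by blast
qed

text \<open>If the top meets the divisors of \<open>U\<close>, some member of \<open>mcm G J\<close>
  divides \<open>U\<close>, and then so does all of \<open>J\<close>. Hence the first set ranges
  only over subsets of the finite set \<open>I \<inter> classes_upto U\<close>.\<close>

lemma towers_below_rec:
  assumes U: "U \<in> div_classes G" and I: "tower_base I" "I \<inter> classes_upto U \<noteq> {}"
  shows "towers_below I U = insert []
    (\<Union>J\<in>{J. J \<subseteq> I \<inter> classes_upto U \<and> 1 < card J}. (#) J ` towers_below (mcm G J) U)"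
    (is "?L = ?R")
proof (intro equalityI subsetI)
  fix Js assume Js: "Js \<in> ?L"
  show "Js \<in> ?R"
  proof (cases Js)
    case (Cons J Js')
    have T: "J \<subseteq> I" "1 < card J" "Js' \<in> towers_below (mcm G J) U"
      using Js by (auto simp: Cons towers_below_def is_tower_Cons tower_top_Cons)
    obtain W where W: "W \<in> mcm G J" "W \<preceq> U" using towers_below_ground[OF U T(3)] by blast
    have "J \<subseteq> classes_upto U"
    proof
      fix V assume V: "V \<in> J"
      then have "V \<in> div_classes G" using T(1) I(1) tower_baseD by blast
      then show "V \<in> classes_upto U"
        using class_le_trans[OF mcm_multiple[OF W(1) V] W(2)] W mcm_subset U by blast
    qed
    then show ?thesis using T Cons by blast
  qed simp
next
  fix Js assume "Js \<in> ?R"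
  then show "Js \<in> ?L"
    using I by (auto simp: towers_below_def is_tower_Nil tower_top_Nil is_tower_Cons tower_top_Cons)
qed

definition tower_weight :: "'a set set \<Rightarrow> 'a set \<Rightarrow> 'a set set list \<Rightarrow> int" where
  "tower_weight I U Js = tower_sgn Js * int (card (tower_top G (I, Js) \<inter> classes_upto U))"

lemma sum_tower_weight:
  assumes U: "U \<in> div_classes G" and I: "tower_base I" "I \<inter> classes_upto U \<noteq> {}"
  shows "finite (towers_below I U) \<and> sum (tower_weight I U) (towers_below I U) = 1"
  using I
  \<comment> \<open>The part below \<open>U\<close> of the up-set of \<open>I\<close> shrinks on passing to \<open>mcm J\<close>: it loses each
    \<open>V \<in> J\<close>, since an element of \<open>mcm J\<close> below \<open>V\<close> would put the other members of \<open>J\<close> below \<open>V\<close>.\<close>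
proof (induction "card {V \<in> classes_upto U. \<exists>W\<in>I. W \<preceq> V}" arbitrary: I rule: less_induct)
  case less
  let ?A = "I \<inter> classes_upto U"
  let ?L = "{J. J \<subseteq> ?A \<and> 1 < card J}"
  have finA: "finite ?A" using finite_classes_upto[OF U] by blast
  then have finL: "finite ?L"
    by (intro finite_subset[of ?L "Pow ?A"] finite_Pow_iff[THEN iffD2]) blast
  have IH: "finite (towers_below (mcm G J) U) \<and>
      sum (tower_weight (mcm G J) U) (towers_below (mcm G J) U) = 1" if J: "J \<in> ?L" for J
  proof (rule less.hyps)
    \<comment> \<open>Two members are needed: \<open>V\<close> is the class that leaves the up-set,
      and \<open>V'\<close> would lie below \<open>V\<close> if it stayed, against \<open>I\<close>
      being an antichain.\<close>
    obtain V V' where V: "V \<in> J" "V' \<in> J" "V \<noteq> V'"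
      using J card_le_Suc0_iff_eq[of J] by (metis (no_types, lifting) One_nat_def card.infinite
          linorder_not_less mem_Collect_eq not_less_zero)
    have JU: "V \<in> div_classes G \<and> V \<preceq> U" if "V \<in> J" for V using J that by blast
    \<comment> \<open>\<open>U\<close> is itself a common multiple of \<open>J\<close>, so a minimal
      one lies below it.\<close>
    have "U \<in> cm G J" using J U by (auto simp: cm_def)
    then obtain X where X: "X \<in> mcm G J" "X \<preceq> U"
      using ex_minimal_class_below[of "cm G J" U] unfolding mcm_def cm_def by blast
    then show "mcm G J \<inter> classes_upto U \<noteq> {}" using mcm_subset by blast
    then show "tower_base (mcm G J)" using tower_base_mcm[OF less.prems(1)] J V by blast
    have "{Y \<in> classes_upto U. \<exists>W\<in>mcm G J. W \<preceq> Y} \<subseteq> {Y \<in> classes_upto U. \<exists>W\<in>I. W \<preceq> Y}"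
      using J V JU mcm_subset class_le_trans[OF mcm_multiple[OF _ V(1)]] by blast
    moreover have "V \<in> {Y \<in> classes_upto U. \<exists>W\<in>I. W \<preceq> Y}"
      using J V JU class_le_refl by blast
    moreover have "V \<notin> {Y \<in> classes_upto U. \<exists>W\<in>mcm G J. W \<preceq> Y}"
    proof
      assume "V \<in> {Y \<in> classes_upto U. \<exists>W\<in>mcm G J. W \<preceq> Y}"
      then obtain W where W: "W \<in> mcm G J" "W \<preceq> V" by blast
      then have "V' \<preceq> V"
        using class_le_trans[OF mcm_multiple[OF W(1) V(2)] W(2)] V JU mcm_subset by blast
      then show False using tower_base_antichain[OF less.prems(1)] V J by blast
    qed
    ultimately show "card {Y \<in> classes_upto U. \<exists>W\<in>mcm G J. W \<preceq> Y}
        < card {Y \<in> classes_upto U. \<exists>W\<in>I. W \<preceq> Y}"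
      by (intro psubset_card_mono finite_subset[OF _ finite_classes_upto[OF U]]) blast+
  qed
  let ?T = "\<lambda>J. (#) J ` towers_below (mcm G J) U"
  have fin: "finite (\<Union>J\<in>?L. ?T J)" using finL IH by blast
  \<comment> \<open>Prefixing \<open>J\<close> keeps the top and multiplies the sign by
    \<open>(-1) ^ (card J - 1)\<close>; the remaining weights add up to 1 by induction.\<close>
  have sum_T: "sum (tower_weight I U) (?T J) = (-1) ^ (card J - 1)" if "J \<in> ?L" for J
  proof -
    have "sum (tower_weight I U) (?T J)
        = (\<Sum>Js\<in>towers_below (mcm G J) U. (-1) ^ (card J - 1) * tower_weight (mcm G J) U Js)"
      by (subst sum.reindex) (simp_all add: tower_weight_def tower_sgn_Cons tower_top_Cons mult.assoc)
    then show ?thesis using IH[OF that] by (simp flip: sum_distrib_left)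
  qed
  \<comment> \<open>The families are disjoint, as their lists differ in the first entry.\<close>
  have "sum (tower_weight I U) (\<Union>J\<in>?L. ?T J) = (\<Sum>J\<in>?L. sum (tower_weight I U) (?T J))"
    by (rule sum.UNION_disjoint) (use finL IH in auto)
  also have "\<dots> = (\<Sum>J\<in>?L. (-1) ^ (card J - 1))"
    by (rule sum.cong[OF refl]) (rule sum_T)
  finally have U: "sum (tower_weight I U) (\<Union>J\<in>?L. ?T J) = (\<Sum>J\<in>?L. (-1) ^ (card J - 1))" .
  have Nil: "[] \<notin> (\<Union>J\<in>?L. ?T J)" by blast
  \<comment> \<open>The list \<open>[]\<close> is the tower of height 0 with top \<open>I\<close>,
    and contributes \<open>card ?A\<close>.\<close>
  have "sum (tower_weight I U) (towers_below I U) = int (card ?A) + (\<Sum>J\<in>?L. (-1) ^ (card J - 1))"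
    unfolding towers_below_rec[OF assms(1) less.prems] sum.insert[OF fin Nil] U
    by (simp add: tower_weight_def tower_top_Nil)
  also have "\<dots> = 1"
    by (rule sum_alternating_large_subsets[OF finA less.prems(2)])
  finally show ?case
    using fin unfolding towers_below_rec[OF assms(1) less.prems] by simp
qed

text \<open>A single member already forces both hypotheses on \<open>I\<close> in
  \<open>sum_tower_weight\<close>; without members there is nothing to show.\<close>

lemma finite_towers_below: "U \<in> div_classes G \<Longrightarrow> finite (towers_below I U)"
proof (cases "towers_below I U = {}")
  case False
  assume U: "U \<in> div_classes G"
  obtain Js where Js: "Js \<in> towers_below I U" using False by blast
  then have "tower_base I" unfolding towers_below_def by (blast dest: is_tower_base)
  then show ?thesis using sum_tower_weight[OF U _ towers_below_ground[OF U Js]] by blast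
qed simp

section \<open>The inversion formula\<close>

abbreviation towers :: "'a tower set" where
  "towers \<equiv> Tmcm G (ground G)"

lemma towers_eq: "towers = Pair (ground G) ` {Js. is_tower G (ground G, Js)}"
  by (auto simp: Tmcm_def)

lemma tower_top_subset: "T \<in> towers \<Longrightarrow> tower_top G T \<subseteq> div_classes G"
  using tower_top_above unfolding towers_eq by blast

lemma towers_meeting_eq:
  "{T \<in> towers. tower_top G T \<inter> classes_upto U \<noteq> {}} = Pair (ground G) ` towers_below (ground G) U"
  unfolding towers_eq towers_below_def by blast

text \<open>\<open>V\<close> divides itself, so these towers belong to
  \<open>towers_below (ground G) V\<close>.\<close>

lemma finite_towers_through:
  assumes "V \<in> div_classes G"
  shows "finite {T \<in> towers. V \<in> tower_top G T}"
proof (rule finite_subset)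
  show "{T \<in> towers. V \<in> tower_top G T} \<subseteq> Pair (ground G) ` towers_below (ground G) V"
    using assms class_le_refl[OF assms] unfolding towers_meeting_eq[symmetric] by blast
qed (simp add: finite_towers_below assms)

text \<open>The total coefficient that \<open>V\<close> receives in the skew-growth function: the
  constant 1 is credited to the identity class, and the minus sign is the extra 1 in the exponent of
  \<open>tower_sign\<close>.\<close>

definition moebius :: "'a set \<Rightarrow> int" where
  "moebius V = (if V = identity_class G then 1 else 0)
    - (\<Sum>T | T \<in> towers \<and> V \<in> tower_top G T. tower_sgn (snd T))"

text \<open>The defining relation of the Moebius function. After exchanging the sums, the towers
  contribute 1 if \<open>U\<close> is not the identity class, cancelling the credit of that class,
  and 0 otherwise.\<close>

lemma sum_moebius:
  assumes U: "U \<in> div_classes G"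
  shows "(\<Sum>V\<in>classes_upto U. moebius V) = (if U = identity_class G then 1 else 0)"
proof -
  let ?B = "towers_below (ground G) U"
  let ?T = "Pair (ground G) ` ?B"
  have fin: "finite (classes_upto U)" "finite ?T"
    using U by (simp_all add: finite_classes_upto finite_towers_below)
  \<comment> \<open>Restricting to the finite set \<open>?T\<close> of towers that meet the divisors
    of \<open>U\<close> allows the exchange.\<close>
  have "(\<Sum>V\<in>classes_upto U. \<Sum>T | T \<in> towers \<and> V \<in> tower_top G T. tower_sgn (snd T))
      = (\<Sum>V\<in>classes_upto U. \<Sum>T | T \<in> ?T \<and> V \<in> tower_top G T. tower_sgn (snd T))"
    unfolding towers_meeting_eq[symmetric] by (intro sum.cong) auto
  also have "\<dots> = (\<Sum>T\<in>?T. \<Sum>V | V \<in> classes_upto U \<and> V \<in> tower_top G T. tower_sgn (snd T))"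
    by (rule sum.swap_restrict[OF fin])
  also have "\<dots> = (\<Sum>Js\<in>?B. tower_weight (ground G) U Js)"
    by (subst sum.reindex) (auto simp: inj_on_def tower_weight_def Int_def conj_commute mult.commute
        intro!: sum.cong arg_cong[of _ _ card])
  also have "\<dots> = (if U = identity_class G then 0 else 1)"
  proof (cases "U = identity_class G")
    case True
    have "?B = {}"
    proof (rule ccontr)
      assume "?B \<noteq> {}"
      then obtain Js V where "is_tower G (ground G, Js)" "V \<in> tower_top G (ground G, Js)" "V \<preceq> U"
        unfolding towers_below_def by blast
      then show False
        using tower_top_above class_le_antisym[of V U] identity_class_le True U by metis
    qed
    then show ?thesis using True by simp
  next
    case False
    let ?C = "div_classes G - {identity_class G}"
    \<comment> \<open>A minimal class below \<open>U\<close> shows both that the ground is nonempty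
      and that it meets the divisors of \<open>U\<close>.\<close>
    obtain V where V: "V \<in> ground G" "V \<preceq> U"
      using ex_minimal_class_below[of ?C U] False U unfolding ground_def by blast
    have sub: "ground G \<subseteq> ?C" unfolding ground_def by (rule minimal_classes_subset)
    have "ground G = minimal_classes G (ground G)" by (simp add: ground_def minimal_classes_idem)
    then have "tower_base (ground G)" using V sub unfolding tower_base_def by blast
    moreover have "ground G \<inter> classes_upto U \<noteq> {}" using V sub by blast
    ultimately show ?thesis using sum_tower_weight[OF U] False by simp
  qed
  finally have "(\<Sum>V\<in>classes_upto U. \<Sum>T | T \<in> towers \<and> V \<in> tower_top G T. tower_sgn (snd T))
      = (if U = identity_class G then 0 else 1)" .
  moreover have "(\<Sum>V\<in>classes_upto U. if V = identity_class G then 1 else 0 :: int) = 1"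
    using fin identity_class_le[OF U] by (simp add: sum.delta')
  ultimately show ?thesis by (simp add: moebius_def sum_subtractf)
qed

section \<open>Coefficients of the growth and skew-growth functions\<close>

lemma finite_monoms:
  assumes "X \<subseteq> div_classes G"
  shows "finite {U \<in> X. \<exists>d\<le>r. rz_coeff (rz_monom (cdeg U)) d \<noteq> 0}"
  by (rule finite_subset[OF _ finite_cdeg_le[of r]])
    (use assms in \<open>auto simp: rz_monom.rep_eq split: if_splits\<close>)

lemma coeff_infsum_monoms:
  assumes X: "X \<subseteq> div_classes G"
  shows "rz_coeff (\<Sum>\<^sub>\<infinity>U\<in>X. rz_monom (cdeg U)) d = int (card {U \<in> X. cdeg U = d})"
proof -
  have "finite {U \<in> X. cdeg U = d}"
    by (rule finite_subset[OF _ finite_cdeg_eq[of d]]) (use X in auto)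
  then have "rz_coeff (\<Sum>\<^sub>\<infinity>U\<in>X. rz_monom (cdeg U)) d
      = (\<Sum>U\<in>{U \<in> X. cdeg U = d}. rz_coeff (rz_monom (cdeg U)) d)"
    by (intro rz_coeff_infsum finite_monoms[OF X]) (auto simp: rz_monom.rep_eq split: if_splits)
  also have "\<dots> = (\<Sum>U\<in>{U \<in> X. cdeg U = d}. 1)"
    \<comment> \<open>\<open>rz_monom\<close> is 0 for a negative exponent, so
      \<open>cdeg_nonneg\<close> is needed for the coefficient to be 1.\<close>
    by (rule sum.cong) (use X cdeg_nonneg in \<open>auto simp: rz_monom.rep_eq\<close>)
  finally show ?thesis by simp
qed

lemma coeff_growth: "rz_coeff (growth G deg) d = int (card {U \<in> div_classes G. cdeg U = d})"
  unfolding growth_def by (rule coeff_infsum_monoms) simp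

lemma coeff_tower_term:
  assumes "T \<in> towers"
  shows "rz_coeff (tower_term G deg T) d = - tower_sgn (snd T) * int (card {V \<in> tower_top G T. cdeg V = d})"
proof -
  obtain Js where T: "T = (ground G, Js)" "is_tower G (ground G, Js)"
    using assms by (auto simp: towers_eq)
  then show ?thesis
    unfolding tower_term_def T(1) tower_sign_eq[OF T(2)] rz_coeff_neg1_power_mult
    using coeff_infsum_monoms[OF tower_top_subset[OF assms], unfolded T(1)] by (simp add: tower_sgn_def)
qed

lemma coeff_tower_term_nonzero:
  assumes "T \<in> towers" "rz_coeff (tower_term G deg T) d \<noteq> 0"
  shows "\<exists>V\<in>div_classes G. cdeg V = d \<and> V \<in> tower_top G T"
proof -
  have "{V \<in> tower_top G T. cdeg V = d} \<noteq> {}"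
    using assms coeff_tower_term[OF assms(1), of d] by (metis card.empty mult_zero_right of_nat_0)
  then show ?thesis using tower_top_subset[OF assms(1)] by blast
qed

text \<open>A term with an exponent at most \<open>r\<close> has a class of degree at most
  \<open>r\<close> in its top; there are finitely many such classes and finitely many towers through
  each.\<close>

lemma finite_tower_terms: "finite {T \<in> towers. \<exists>d\<le>r. rz_coeff (tower_term G deg T) d \<noteq> 0}"
proof (rule finite_subset)
  show "{T \<in> towers. \<exists>d\<le>r. rz_coeff (tower_term G deg T) d \<noteq> 0}
      \<subseteq> (\<Union>V\<in>{V \<in> div_classes G. cdeg V \<le> r}. {T \<in> towers. V \<in> tower_top G T})"
    using coeff_tower_term_nonzero by blast
  show "finite (\<Union>V\<in>{V \<in> div_classes G. cdeg V \<le> r}. {T \<in> towers. V \<in> tower_top G T})"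
    using finite_cdeg_le finite_towers_through by blast
qed

lemma coeff_skew_growth:
  "rz_coeff (skew_growth G deg) d = (\<Sum>V | V \<in> div_classes G \<and> cdeg V = d. moebius V)"
proof -
  let ?D = "{V \<in> div_classes G. cdeg V = d}"
  \<comment> \<open>A finite set containing every tower whose term has a nonzero coefficient at
    \<open>d\<close>.\<close>
  let ?B = "\<Union>V\<in>?D. {T \<in> towers. V \<in> tower_top G T}"
  have finB: "finite ?B" using finite_cdeg_eq finite_towers_through by blast
  have "rz_coeff (\<Sum>\<^sub>\<infinity>T\<in>towers. tower_term G deg T) d = (\<Sum>T\<in>?B. rz_coeff (tower_term G deg T) d)"
    using finB coeff_tower_term_nonzero by (intro rz_coeff_infsum finite_tower_terms) blast+
  also have "\<dots> = (\<Sum>T\<in>?B. \<Sum>V | V \<in> ?D \<and> V \<in> tower_top G T. - tower_sgn (snd T))"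
  proof (rule sum.cong[OF refl])
    fix T assume "T \<in> ?B"
    then have T: "T \<in> towers" by blast
    have "{V \<in> tower_top G T. cdeg V = d} = {V \<in> ?D. V \<in> tower_top G T}"
      using tower_top_subset[OF T] by blast
    then show "rz_coeff (tower_term G deg T) d = (\<Sum>V | V \<in> ?D \<and> V \<in> tower_top G T. - tower_sgn (snd T))"
      by (simp add: coeff_tower_term[OF T])
  qed
  also have "\<dots> = (\<Sum>V\<in>?D. \<Sum>T | T \<in> ?B \<and> V \<in> tower_top G T. - tower_sgn (snd T))"
    by (rule sum.swap_restrict[OF finB finite_cdeg_eq])
  also have "\<dots> = (\<Sum>V\<in>?D. - (\<Sum>T | T \<in> towers \<and> V \<in> tower_top G T. tower_sgn (snd T)))"
    unfolding sum_negf[symmetric] by (intro sum.cong) auto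
  finally have "rz_coeff (\<Sum>\<^sub>\<infinity>T\<in>towers. tower_term G deg T) d
      = (\<Sum>V\<in>?D. - (\<Sum>T | T \<in> towers \<and> V \<in> tower_top G T. tower_sgn (snd T)))" .
  \<comment> \<open>The identity class is the only class of degree 0.\<close>
  moreover have "rz_coeff 1 d = (\<Sum>V\<in>?D. if V = identity_class G then 1 else 0)"
    using cdeg_eq_0_iff[OF identity_class_in] finite_cdeg_eq[of d]
    by (auto simp: rz_coeff_1 sum.delta')
  ultimately show ?thesis
    by (simp add: skew_growth_def rz_coeff_add moebius_def flip: sum.distrib)
qed

lemma growth_mult_skew_growth: "growth G deg * skew_growth G deg = 1"
proof (rule rz_series_eqI)
  fix d
  let ?E = "{V \<in> div_classes G. cdeg V \<le> d}" and ?D = "\<lambda>d. {U \<in> div_classes G. cdeg U = d}"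
  have finE: "finite ?E" by (rule finite_cdeg_le)
  have "rz_coeff (growth G deg * skew_growth G deg) d
      = (\<Sum>a\<in>cdeg ` ?E. rz_coeff (skew_growth G deg) a * rz_coeff (growth G deg) (d - a))"
    unfolding rz_mult_commute[of "growth G deg"]
  proof (rule rz_coeff_times_left)
    show "{a. a \<le> d \<and> rz_coeff (skew_growth G deg) a \<noteq> 0} \<subseteq> cdeg ` ?E"
    proof clarify
      fix a assume a: "a \<le> d" "rz_coeff (skew_growth G deg) a \<noteq> 0"
      then have "?D a \<noteq> {}" unfolding coeff_skew_growth by (metis sum.empty)
      then show "a \<in> cdeg ` ?E" using a(1) by blast
    qed
  qed (use finE in blast)
  \<comment> \<open>Grouping classes by degree turns the convolution over exponents into one sum
    over classes \<open>V\<close>.\<close>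
  also have "\<dots> = (\<Sum>a\<in>cdeg ` ?E. \<Sum>V | V \<in> ?E \<and> cdeg V = a. moebius V * int (card (?D (d - cdeg V))))"
    unfolding coeff_skew_growth coeff_growth sum_distrib_right by (intro sum.cong) auto
  also have "\<dots> = (\<Sum>V\<in>?E. moebius V * int (card (?D (d - cdeg V))))"
    by (rule sum.group) (use finE in auto)
  \<comment> \<open>By \<open>card_multiples\<close>, classes of degree \<open>d - cdeg V\<close>
    are as many as multiples of \<open>V\<close> of degree \<open>d\<close>; exchanging the sums
    then leaves a divisor sum of \<open>moebius\<close>.\<close>
  also have "\<dots> = (\<Sum>V\<in>?E. \<Sum>U | U \<in> ?D d \<and> V \<preceq> U. moebius V)"
    by (intro sum.cong) (simp_all add: card_multiples[symmetric] conj_assoc mult.commute)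
  also have "\<dots> = (\<Sum>U\<in>?D d. \<Sum>V | V \<in> ?E \<and> V \<preceq> U. moebius V)"
    by (rule sum.swap_restrict[OF finE finite_cdeg_eq])
  also have "\<dots> = (\<Sum>U\<in>?D d. if U = identity_class G then 1 else 0)"
  proof (rule sum.cong[OF refl])
    fix U assume U: "U \<in> ?D d"
    \<comment> \<open>Divisors of a class of degree \<open>d\<close> have degree at most
      \<open>d\<close>, so the inner sum runs over all of them.\<close>
    then have "{V. V \<in> ?E \<and> V \<preceq> U} = classes_upto U" using cdeg_mono[of _ U] by auto
    then show "(\<Sum>V | V \<in> ?E \<and> V \<preceq> U. moebius V) = (if U = identity_class G then 1 else 0)"
      using sum_moebius[of U] U by simp
  qed
  also have "\<dots> = rz_coeff 1 d"
    using cdeg_eq_0_iff[OF identity_class_in] finite_cdeg_eq[of d]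
    by (auto simp: rz_coeff_1 sum.delta')
  finally show "rz_coeff (growth G deg * skew_growth G deg) d = rz_coeff 1 d" .
qed

section \<open>Convergence of the series\<close>

lemma growth_converges: "growth_converges G deg"
  unfolding growth_converges_def by (rule rz_summable_on[OF finite_monoms]) simp

lemma skew_growth_converges: "skew_growth_converges G deg"
  unfolding skew_growth_converges_def
proof (intro conjI ballI)
  fix T assume "T \<in> towers"
  then show "(\<lambda>U. rz_monom (cdeg U)) summable_on tower_top G T"
    by (intro rz_summable_on finite_monoms tower_top_subset)
next
  show "tower_term G deg summable_on towers"
    by (rule rz_summable_on) (rule finite_tower_terms)
qed

end

theorem mainTheorem1:
  fixes M :: "('a, 'b) monoid_scheme" and deg :: "'a \<Rightarrow> real"
  assumes "monoid_cancel M" and "discrete_degree M deg"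
  shows "growth_converges M deg \<and> skew_growth_converges M deg \<and>
    growth M deg * skew_growth M deg = 1"
proof -
  interpret graded_cancel_monoid M deg
    using assms by (simp add: graded_cancel_monoid_def graded_cancel_monoid_axioms_def)
  show ?thesis
    using growth_converges skew_growth_converges growth_mult_skew_growth by blast
qed

end
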